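(* Let $X$ be an implicative-ortholattice. The following are equivalent: (a) $X$ is an implicative-orthomodular lattice; (b) $(x\to y)\to(y\wedge_Q x)=x$ for all $x,y\in X$; (c) for all $x,y\in X$, $x\le y$ and $y\le_L x$ imply $x=y$; (d) for all $x,y\in X$, $x\wedge_Q y^*=0$ implies $x\wedge_Q y=x$; (e) $x\to(x\wedge_Q y)=x\to y$ for all $x,y\in X$.
   Context: A BE algebra is an algebra $(X,\to,1)$ such that for all $x,y,z\in X$: $x\to x=1$; $x\to 1=1$; $1\to x=x$; $x\to(y\to z)=y\to(x\to z)$. It carries the relation $x\le y$ iff $x\to y=1$. It is bounded if there is $0\in X$ with $0\le x$ for all $x\in X$; then $x^*:=x\to 0$ (so $0=1^*$) and the algebra is written $(X,\to,{}^*,1)$. It is involutive if $x^{**}=x$ for all $x$, and implicative if $(x\to y)\to x=x$ for all $x,y$. An implicative-ortholattice is an implicative involutive (bounded) BE algebra. Put $x\wedge_Q y:=((x^*\to y^* )\to y^* )^*$, and $x\le_L y$ iff $x=(x\to y^* )^*$. An implicative-orthomodular lattice is an implicative-ortholattice with $x\wedge_Q(y\to x)=x$ for all $x,y$. *)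

theory Defs
  imports Main
begin

definition be_le :: "('a \<Rightarrow> 'a \<Rightarrow> 'a) \<Rightarrow> 'a \<Rightarrow> 'a \<Rightarrow> 'a \<Rightarrow> bool" where
  "be_le imp one x y \<longleftrightarrow> imp x y = one"

definition be_star :: "('a \<Rightarrow> 'a \<Rightarrow> 'a) \<Rightarrow> 'a \<Rightarrow> 'a \<Rightarrow> 'a" where
  "be_star imp zero x = imp x zero"

definition be_meetQ :: "('a \<Rightarrow> 'a \<Rightarrow> 'a) \<Rightarrow> 'a \<Rightarrow> 'a \<Rightarrow> 'a \<Rightarrow> 'a" where
  "be_meetQ imp zero x y =
     be_star imp zero
       (imp (imp (be_star imp zero x) (be_star imp zero y)) (be_star imp zero y))"

definition be_leL :: "('a \<Rightarrow> 'a \<Rightarrow> 'a) \<Rightarrow> 'a \<Rightarrow> 'a \<Rightarrow> 'a \<Rightarrow> bool" where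
  "be_leL imp zero x y \<longleftrightarrow> x = be_star imp zero (imp x (be_star imp zero y))"

text \<open>
  The underlying set of an algebra is the whole (arbitrary, nonempty) type \<open>'a\<close>.
\<close>

locale be_algebra =
  fixes imp :: "'a \<Rightarrow> 'a \<Rightarrow> 'a" (infixr "\<leadsto>" 65)
    and one :: 'a
  assumes imp_self: "x \<leadsto> x = one"
    and imp_one: "x \<leadsto> one = one"
    and one_imp: "one \<leadsto> x = x"
    and imp_exchange: "x \<leadsto> (y \<leadsto> z) = y \<leadsto> (x \<leadsto> z)"

text \<open>
  The relation \<^const>\<open>be_le\<close> need not be antisymmetric, so a bounded BE algebra may have
  several least elements; the one defining the star operation is therefore a parameter.
  In an involutive algebra it is unique.
\<close>

locale bounded_be_algebra = be_algebra imp one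
  for imp :: "'a \<Rightarrow> 'a \<Rightarrow> 'a" (infixr "\<leadsto>" 65) and one :: 'a +
  fixes zero :: 'a
  assumes zero_le: "be_le imp one zero x"

locale involutive_be_algebra = bounded_be_algebra +
  assumes star_star: "be_star imp zero (be_star imp zero x) = x"

locale implicative_be_algebra = be_algebra +
  assumes implicative: "(x \<leadsto> y) \<leadsto> x = x"

locale implicative_ortholattice =
  involutive_be_algebra imp one zero + implicative_be_algebra imp one
  for imp :: "'a \<Rightarrow> 'a \<Rightarrow> 'a" (infixr "\<leadsto>" 65) and one zero :: 'a

locale implicative_orthomodular_lattice = implicative_ortholattice +
  assumes orthomodular: "be_meetQ imp zero x (y \<leadsto> x) = x"

end

theory Submission
  imports Defs "HOL-Library.Complemented_Lattices"
begin

text \<open>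
  An implicative-ortholattice is an ortholattice in disguise. Its order is \<open>\<le>\<^sub>L\<close> (the relation
  \<open>\<le>\<close> is in general not transitive), its orthocomplement is the star, and its implication is the
  material one, \<open>x \<rightarrow> y = x\<^sup>* \<squnion> y\<close>; the implicative axiom becomes the absorption law. Under
  this translation \<open>x \<and>\<^sub>Q y\<close> is the Sasaki projection \<open>(x \<squnion> y\<^sup>*) \<sqinter> y\<close> of \<open>x\<close> onto \<open>y\<close>, and
  the five conditions become well-known forms of the orthomodular law
  \<open>x \<le>\<^sub>L y \<Longrightarrow> x \<squnion> (x\<^sup>* \<sqinter> y) = y\<close>. Conditions (a) and (b) are its dual and the law itself: the
  implications in them only serve to produce an arbitrary pair of comparable elements.
  Condition (c) says that a complement of \<open>x\<^sup>*\<close> that lies below \<open>x\<close> is equal to \<open>x\<close>. It implies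
  the law because, for \<open>x \<le>\<^sub>L y\<close>, the element \<open>x \<squnion> (x\<^sup>* \<sqinter> y)\<close> is such a complement of \<open>y\<^sup>*\<close>.
  Conditions (d) and (e) follow from the law for arbitrary pairs; restricted to comparable ones
  (in (e) with \<open>x\<^sup>*\<close> in place of \<open>x\<close>), they become (c) and the law itself.

  The equivalences are therefore shown for ortholattices, where they are statements about the
  orthomodular law, and are then read off through the translation.
\<close>

section \<open>The orthomodular law in an ortholattice\<close>

context orthocomplemented_lattice
  opening lattice_syntax
begin

abbreviation sasaki :: "'a \<Rightarrow> 'a \<Rightarrow> 'a" where
  "sasaki x y \<equiv> (x \<squnion> - y) \<sqinter> y"

text \<open>The complement exchanges the law with its dual.\<close>

lemma orthomodular_law_iff_dual:
  "(\<forall>x y. x \<le> y \<longrightarrow> x \<squnion> (- x \<sqinter> y) = y) \<longleftrightarrow>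
    (\<forall>x y. x \<le> y \<longrightarrow> sasaki x y = x)"
  (is "?law \<longleftrightarrow> _")
proof (intro iffI allI impI)
  fix x y assume ?law "x \<le> y"
  then have "- y \<squnion> (- (- y) \<sqinter> - x) = - x"
    by (meson compl_mono)
  then have "- (- y \<squnion> (- (- y) \<sqinter> - x)) = x"
    by simp
  then show "sasaki x y = x"
    by (simp add: ac_simps)
next
  fix x y assume "\<forall>x y. x \<le> y \<longrightarrow> sasaki x y = x" "x \<le> y"
  then have "sasaki (- y) (- x) = - y"
    by (meson compl_mono)
  then have "- (sasaki (- y) (- x)) = y"
    by simp
  then show "x \<squnion> (- x \<sqinter> y) = y"
    by (simp add: ac_simps)
qed

text \<open>As \<open>y\<close> varies, \<open>- y \<squnion> x\<close> takes exactly the values above \<open>x\<close>, so the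
  right-hand side is the dual law.\<close>

lemma orthomodular_law_iff_sasaki_sup:
  "(\<forall>x y. x \<le> y \<longrightarrow> x \<squnion> (- x \<sqinter> y) = y) \<longleftrightarrow>
    (\<forall>x y. sasaki x (- y \<squnion> x) = x)"
  (is "?law \<longleftrightarrow> _")
proof -
  have "sasaki x y = x" if "\<forall>x y. sasaki x (- y \<squnion> x) = x" "x \<le> y" for x y
    using that(1)[rule_format, of x "- y"] that(2) by (simp add: sup.absorb1)
  then show ?thesis
    unfolding orthomodular_law_iff_dual by (meson sup_ge2)
qed

text \<open>As \<open>y\<close> varies, \<open>x \<sqinter> - y\<close> takes exactly the values below \<open>x\<close>, and the
  right-hand side is the law for \<open>x \<sqinter> - y \<le> x\<close>.\<close>

lemma orthomodular_law_iff_sup_sasaki: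
  "(\<forall>x y. x \<le> y \<longrightarrow> x \<squnion> (- x \<sqinter> y) = y) \<longleftrightarrow>
    (\<forall>x y. - (- x \<squnion> y) \<squnion> sasaki y x = x)"
  (is "?law \<longleftrightarrow> _")
proof (intro iffI allI impI)
  fix x y assume ?law
  moreover have "x \<sqinter> - y \<le> x" by simp
  ultimately have "(x \<sqinter> - y) \<squnion> (- (x \<sqinter> - y) \<sqinter> x) = x"
    by blast
  then show "- (- x \<squnion> y) \<squnion> sasaki y x = x"
    by (simp add: ac_simps)
next
  fix x y assume *: "\<forall>x y. - (- x \<squnion> y) \<squnion> sasaki y x = x" and "x \<le> y"
  have "y \<sqinter> x = x" "- x \<squnion> - y = - x"
    using \<open>x \<le> y\<close> by (simp_all add: inf.absorb2 sup.absorb1)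
  then show "x \<squnion> (- x \<sqinter> y) = y"
    using *[rule_format, of y "- x"] by simp
qed

text \<open>
  For \<open>y \<le> x\<close>, the law decomposes \<open>x\<close> as \<open>y \<squnion> (- y \<sqinter> x)\<close>, and the second part is
  \<open>- (- x \<squnion> y)\<close>, which vanishes under the hypothesis. Conversely, for \<open>x \<le> y\<close> the lower element
  \<open>x \<squnion> (- x \<sqinter> y)\<close> has with \<open>- y\<close> the join \<open>(x \<squnion> - y) \<squnion> - (x \<squnion> - y)\<close>.
\<close>

lemma orthomodular_law_iff_cancel:
  "(\<forall>x y. x \<le> y \<longrightarrow> x \<squnion> (- x \<sqinter> y) = y) \<longleftrightarrow>
    (\<forall>x y. - x \<squnion> y = \<top> \<and> y \<le> x \<longrightarrow> x = y)"
  (is "?law \<longleftrightarrow> _")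
proof (intro iffI allI impI)
  fix x y assume ?law and *: "- x \<squnion> y = \<top> \<and> y \<le> x"
  then have "y \<squnion> (- y \<sqinter> x) = x" by blast
  moreover have "- y \<sqinter> x = \<bottom>"
  proof -
    have "- (- x \<squnion> y) = \<bottom>" using * by (simp only: compl_top_eq)
    then show ?thesis by (simp add: inf_commute)
  qed
  ultimately show "x = y" by simp
next
  fix x y assume cancel: "\<forall>x y. - x \<squnion> y = \<top> \<and> y \<le> x \<longrightarrow> x = y" and "x \<le> y"
  have "- y \<squnion> (x \<squnion> (- x \<sqinter> y)) = (x \<squnion> - y) \<squnion> - (x \<squnion> - y)"
    by (simp add: ac_simps)
  then have "- y \<squnion> (x \<squnion> (- x \<sqinter> y)) = \<top>"
    by (simp only: sup_compl_top)
  moreover have "x \<squnion> (- x \<sqinter> y) \<le> y"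
    using \<open>x \<le> y\<close> by simp
  ultimately show "x \<squnion> (- x \<sqinter> y) = y"
    using cancel by metis
qed

text \<open>
  Under the law, \<open>(x \<squnion> y) \<sqinter> - y = \<bottom>\<close> forces \<open>x \<squnion> y = y\<close>, because
  \<open>x \<squnion> y = y \<squnion> (- y \<sqinter> (x \<squnion> y))\<close>; and projecting onto a larger element changes nothing. In the other direction, the premise of the cancellation property for \<open>y \<le> x\<close>
  amounts to \<open>sasaki x (- y) = \<bottom>\<close>, and a fixed point of the projection onto \<open>y\<close> lies below \<open>y\<close>.
\<close>

lemma orthomodular_law_iff_sasaki_compl_bot:
  "(\<forall>x y. x \<le> y \<longrightarrow> x \<squnion> (- x \<sqinter> y) = y) \<longleftrightarrow>
    (\<forall>x y. sasaki x (- y) = \<bottom> \<longrightarrow> sasaki x y = x)"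
  (is "?law \<longleftrightarrow> _")
proof
  assume law: ?law
  have "sasaki x y = x" if "sasaki x (- y) = \<bottom>" for x y
  proof -
    have "- y \<sqinter> (x \<squnion> y) = \<bottom>"
      using that by (simp add: inf_commute)
    moreover have "y \<squnion> (- y \<sqinter> (x \<squnion> y)) = x \<squnion> y"
      using law sup_ge2 by blast
    ultimately have "x \<squnion> y = y" by simp
    then have "x \<le> y" by (simp add: le_iff_sup)
    then show ?thesis
      using law unfolding orthomodular_law_iff_dual by blast
  qed
  then show "\<forall>x y. sasaki x (- y) = \<bottom> \<longrightarrow> sasaki x y = x" by blast
next
  assume sas: "\<forall>x y. sasaki x (- y) = \<bottom> \<longrightarrow> sasaki x y = x"
  have "x = y" if "- x \<squnion> y = \<top>" "y \<le> x" for x y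
  proof -
    have "sasaki x (- y) = - (- x \<squnion> y)"
      using \<open>y \<le> x\<close> by (simp add: sup.absorb1)
    then have "sasaki x y = x"
      using sas that by (simp only: compl_top_eq)
    then have "x \<le> y"
      by (metis inf_le2)
    with \<open>y \<le> x\<close> show ?thesis by simp
  qed
  then show ?law
    unfolding orthomodular_law_iff_cancel by blast
qed

text \<open>
  The law splits \<open>y\<close> as \<open>(- x \<sqinter> y) \<squnion> sasaki x y\<close>, and joining with \<open>- x\<close> absorbs the first part.
  The converse is immediate by taking \<open>- x\<close> for \<open>x\<close>: for \<open>x \<le> y\<close> the projection of \<open>- x\<close> onto
  \<open>y\<close> is \<open>- x \<sqinter> y\<close>.
\<close>

lemma orthomodular_law_iff_compl_sup_sasaki:
  "(\<forall>x y. x \<le> y \<longrightarrow> x \<squnion> (- x \<sqinter> y) = y) \<longleftrightarrow>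
    (\<forall>x y. - x \<squnion> sasaki x y = - x \<squnion> y)"
  (is "?law \<longleftrightarrow> _")
proof (intro iffI allI impI)
  fix x y assume ?law
  moreover have "- x \<sqinter> y \<le> y" by simp
  ultimately have "(- x \<sqinter> y) \<squnion> (- (- x \<sqinter> y) \<sqinter> y) = y"
    by blast
  then have "- x \<squnion> y = - x \<squnion> ((- x \<sqinter> y) \<squnion> sasaki x y)"
    by simp
  also have "\<dots> = - x \<squnion> sasaki x y"
    by (simp add: sup_assoc[symmetric])
  finally show "- x \<squnion> sasaki x y = - x \<squnion> y" ..
next
  fix x y assume *: "\<forall>x y. - x \<squnion> sasaki x y = - x \<squnion> y" and "x \<le> y"
  then show "x \<squnion> (- x \<sqinter> y) = y"
    using *[rule_format, of "- x" y] by (simp add: sup.absorb1 sup.absorb2)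
qed

end

section \<open>The ortholattice of an implicative-ortholattice\<close>

context implicative_ortholattice
begin

abbreviation star :: "'a \<Rightarrow> 'a" where
  "star \<equiv> be_star imp zero"

definition join :: "'a \<Rightarrow> 'a \<Rightarrow> 'a" where
  "join x y = star x \<leadsto> y"

definition meet :: "'a \<Rightarrow> 'a \<Rightarrow> 'a" where
  "meet x y = star (x \<leadsto> star y)"

lemma imp_eq_join: "x \<leadsto> y = join (star x) y"
  by (simp add: join_def star_star)

lemma meet_eq_star_join: "meet x y = star (join (star x) (star y))"
  by (simp add: meet_def join_def star_star)

text \<open>The exchange axiom gives contraposition, since \<open>x \<leadsto> star y = x \<leadsto> (y \<leadsto> zero)\<close>.\<close>

lemma imp_star_swap: "x \<leadsto> star y = y \<leadsto> star x"
  unfolding be_star_def by (rule imp_exchange)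

lemma join_commute: "join x y = join y x"
  using imp_star_swap[of "star x" "star y"] by (simp add: join_def star_star)

lemma join_left_commute: "join x (join y z) = join y (join x z)"
  unfolding join_def by (rule imp_exchange)

lemma join_assoc: "join (join x y) z = join x (join y z)"
  using join_left_commute[of z x y] by (simp only: join_commute[of _ z])

text \<open>Contraposition turns \<open>star x \<leadsto> star (x \<leadsto> star y)\<close> into \<open>(x \<leadsto> star y) \<leadsto> x\<close>, so this
  is the implicative axiom.\<close>

lemma join_absorb: "join x (meet x y) = x"
  by (simp add: join_def meet_def imp_star_swap[of "star x"] star_star implicative)

lemma meet_absorb: "meet x (join x y) = x"
proof -
  have "join (star x) (star (join x y)) = star x"
    using join_absorb[of "star x" "star y"] by (simp add: meet_eq_star_join star_star)
  then show ?thesis by (simp add: meet_eq_star_join star_star)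
qed

lemma join_star: "join x (star x) = one"
  using imp_self[of "star x"] by (simp add: join_def)

lemma star_one: "star one = zero"
  by (simp add: be_star_def one_imp)

lemma join_one: "join x one = one"
  by (simp add: join_def imp_one)

lemma leL_iff_meet: "be_leL imp zero x y \<longleftrightarrow> meet x y = x"
  by (auto simp: be_leL_def meet_def)

lemma leL_iff_join: "be_leL imp zero x y \<longleftrightarrow> join x y = y"
  by (metis leL_iff_meet join_absorb meet_absorb join_commute meet_eq_star_join)

lemma meetQ_eq_sasaki: "be_meetQ imp zero x y = meet (join x (star y)) y"
  by (simp add: be_meetQ_def meet_def join_def star_star)

text \<open>
  Join is commutative, associative and satisfies the absorption laws with meet, and the star is an
  involution exchanging the two. Hence the relation \<open>\<le>\<^sub>L\<close>, which says \<open>meet x y = x\<close> and so also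
  \<open>join x y = y\<close>, is the order of a lattice, and the star reverses it.
\<close>

lemma orthocomplemented_lattice_leL:
  "class.orthocomplemented_lattice (\<lambda>x y. meet x (star y)) star meet (be_leL imp zero)
     (\<lambda>x y. be_leL imp zero x y \<and> \<not> be_leL imp zero y x) join zero one"
proof
  fix x y z
  have meet_commute: "meet a b = meet b a" for a b
    by (simp add: meet_eq_star_join join_commute)
  have star_mono: "be_leL imp zero (star b) (star a)" if "be_leL imp zero a b" for a b
    using that by (metis leL_iff_join leL_iff_meet meet_eq_star_join star_star join_commute)
  have trans: "be_leL imp zero a c" if "be_leL imp zero a b" "be_leL imp zero b c" for a b c
    using that by (metis leL_iff_join join_assoc)
  have le_join: "be_leL imp zero a (join a b)" for a b
    by (simp add: leL_iff_meet meet_absorb)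
  have meet_le: "be_leL imp zero (meet a b) a" for a b
    by (metis leL_iff_join join_absorb join_commute)
  have join_le: "be_leL imp zero (join a b) c"
    if "be_leL imp zero a c" "be_leL imp zero b c" for a b c
    using that by (simp add: leL_iff_join join_assoc)
  show "be_leL imp zero x x"
    by (metis leL_iff_meet join_absorb meet_absorb)
  show "be_leL imp zero x z" if "be_leL imp zero x y" "be_leL imp zero y z"
    using that by (rule trans)
  show "x = y" if "be_leL imp zero x y" "be_leL imp zero y x"
    using that by (metis leL_iff_join join_commute)
  show "be_leL imp zero (meet x y) x" by (rule meet_le)
  show "be_leL imp zero (meet x y) y" by (metis meet_le meet_commute)
  show "be_leL imp zero x (meet y z)" if "be_leL imp zero x y" "be_leL imp zero x z"
    using star_mono[OF join_le[OF star_mono[OF that(1)] star_mono[OF that(2)]]]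
    by (simp add: meet_eq_star_join star_star)
  show "be_leL imp zero x (join x y)" by (rule le_join)
  show "be_leL imp zero y (join x y)" by (metis le_join join_commute)
  show "be_leL imp zero (join y z) x" if "be_leL imp zero y x" "be_leL imp zero z x"
    using that by (rule join_le)
  show "be_leL imp zero x one"
    by (simp add: leL_iff_join join_one)
  show "be_leL imp zero zero x"
    by (metis leL_iff_meet meet_def star_one be_le_def zero_le)
  show "meet x (star x) = zero"
    by (simp add: meet_eq_star_join join_star star_one)
  show "join x (star x) = one" by (rule join_star)
  show "star (star x) = x" by (rule star_star)
  show "be_leL imp zero (star y) (star x)" if "be_leL imp zero x y"
    using that by (rule star_mono)
qed auto

end

section \<open>The characterizations\<close>

theorem theorem2p20:
  fixes imp :: "'a \<Rightarrow> 'a \<Rightarrow> 'a" (infixr "\<leadsto>" 65)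
    and one zero :: 'a
  assumes "implicative_ortholattice imp one zero"
  shows
    "(implicative_orthomodular_lattice imp one zero \<longleftrightarrow>
        (\<forall>x y. (x \<leadsto> y) \<leadsto> be_meetQ imp zero y x = x)) \<and>
     (implicative_orthomodular_lattice imp one zero \<longleftrightarrow>
        (\<forall>x y. be_le imp one x y \<and> be_leL imp zero y x \<longrightarrow> x = y)) \<and>
     (implicative_orthomodular_lattice imp one zero \<longleftrightarrow>
        (\<forall>x y. be_meetQ imp zero x (be_star imp zero y) = zero \<longrightarrow> be_meetQ imp zero x y = x)) \<and>
     (implicative_orthomodular_lattice imp one zero \<longleftrightarrow>
        (\<forall>x y. x \<leadsto> be_meetQ imp zero x y = x \<leadsto> y))"
proof -
  interpret X: implicative_ortholattice imp one zero by fact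
  interpret L: orthocomplemented_lattice "\<lambda>x y. X.meet x (X.star y)" X.star X.meet "be_leL imp zero"
    "\<lambda>x y. be_leL imp zero x y \<and> \<not> be_leL imp zero y x" X.join zero one
    by (rule X.orthocomplemented_lattice_leL)
  let ?law = "\<forall>x y. be_leL imp zero x y \<longrightarrow> X.join x (X.meet (X.star x) y) = y"
  have a: "implicative_orthomodular_lattice imp one zero \<longleftrightarrow> ?law"
    by (simp only: implicative_orthomodular_lattice_def implicative_orthomodular_lattice_axioms_def
      assms simp_thms X.imp_eq_join X.meetQ_eq_sasaki L.orthomodular_law_iff_sasaki_sup)
  have b: "?law \<longleftrightarrow> (\<forall>x y. (x \<leadsto> y) \<leadsto> be_meetQ imp zero y x = x)"
    by (simp only: X.imp_eq_join X.meetQ_eq_sasaki L.orthomodular_law_iff_sup_sasaki)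
  have c: "?law \<longleftrightarrow> (\<forall>x y. be_le imp one x y \<and> be_leL imp zero y x \<longrightarrow> x = y)"
    by (simp only: be_le_def X.imp_eq_join L.orthomodular_law_iff_cancel)
  have d: "?law \<longleftrightarrow>
      (\<forall>x y. be_meetQ imp zero x (X.star y) = zero \<longrightarrow> be_meetQ imp zero x y = x)"
    by (simp only: X.meetQ_eq_sasaki L.orthomodular_law_iff_sasaki_compl_bot)
  have e: "?law \<longleftrightarrow> (\<forall>x y. x \<leadsto> be_meetQ imp zero x y = x \<leadsto> y)"
    by (simp only: X.imp_eq_join X.meetQ_eq_sasaki L.orthomodular_law_iff_compl_sup_sasaki)
  show ?thesis
    unfolding a by (intro conjI b c d e)
qed

end
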